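(* Let $\alpha>0$ be an ordinal such that there are no hyperinaccessible cardinals below $\alpha$. Then, if $\mathrm{LST}(I,R^\alpha)$ exists, it is at least the first element of $\mathrm{Reg}_\alpha$.
   Context: Classes of regular cardinals. $\mathrm{Reg}$ is the class of infinite regular cardinals. By recursion on ordinals $\alpha$: $\mathrm{Reg}_{<\alpha}=\bigcup_{\beta<\alpha}\mathrm{Reg}_\beta$; $\mathrm{Reg}_{\geq\alpha}=\mathrm{Reg}\setminus \mathrm{Reg}_{<\alpha}$; and $\mathrm{Reg}_\alpha$ is the class of successor elements of the closed class of ordinals generated by $\mathrm{Reg}_{\geq\alpha}$ (i.e. those elements of its closure that have an immediate predecessor in the closure; the minimum element $\omega$ is not a successor). So $\mathrm{Reg}_0$ is the class of uncountable successor cardinals. A cardinal $\epsilon$ is hyperinaccessible if $\epsilon\in\mathrm{Reg}_\epsilon$. Generalised quantifiers. A generalised quantifier $Q$ of type $(n_1,\dots,n_k)$ assigns to each set $A$ a set $Q_A\subset \mathcal P(A^{n_1})\times\dots\times\mathcal P(A^{n_k})$. If $\mathcal A$ is a structure with domain $A$, the formula $Q\bar v_1\dots\bar v_k(\varphi_1,\dots,\varphi_k)$ (with $\bar v_i$ an $n_i$-tuple of variables, $\varphi_i$ possibly with further parameters) is true in $\mathcal A$ under an assignment $a$ iff $(S_1,\dots,S_k)\in Q_A$, where $S_i=\{\bar x\in A^{n_i}:\mathcal A\vDash\varphi_i(\bar x)[a]\}$. Such quantifiers may be nested and combined freely with first-order connectives and quantifiers. Cardinalities are computed in the universe $V$.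 - The H\"artig quantifier $I$ has type $(1,1)$: $I_A=\{(X,Y)\in\mathcal P(A)^2: |X|=|Y|\}$. - $R^\alpha$ has type $(1,2)$: $R^\alpha_A$ is the set of $(X,Z)\in\mathcal P(A)\times\mathcal P(A^2)$ such that $Z$ is a well order of order type less than $\alpha$ and $|X|\in\mathrm{Reg}_{\mathrm{o.t.}(Z)}$. LST numbers. $\mathrm{LST}(Q_0,\dots,Q_n)$ is the least infinite cardinal $\kappa$ such that for every first-order vocabulary $\mathcal L$ with $|\mathcal L|<\kappa$, every $\mathcal L$-structure $\mathcal A$ has a substructure of cardinality less than $\kappa$ that is elementary for all formulas of the language $\mathcal L\cup\{Q_0,\dots,Q_n\}$. If there is no such $\kappa$, the LST number does not exist (equivalently, is $\infty$). If $\mathrm{Reg}_\alpha=\emptyset$, its first element is read as $\infty$. *)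

theory Defs
  imports "HOL-Library.Equipollence" "HOL.Hull"
begin

section \<open>The universe of sets\<close>

text \<open>
  The universe \<open>V\<close> is an arbitrary type carrying a membership structure that satisfies the
  axioms of ZFC, with separation and replacement for all HOL predicates and functions (choice for
  sets is inherited from HOL). A class is a HOL set of elements of the universe; it is a set
  if it is \<open>small\<close>. By replacement, a HOL bijection between \<open>elts x\<close> and \<open>elts y\<close> amounts to a
  bijection inside the universe, so equipollence of classes \<open>elts x\<close> is
  equality of cardinalities computed in \<open>V\<close>.
\<close>

class zfc_universe =
  fixes elts :: "'a \<Rightarrow> 'a set"
  assumes extensionality: "elts x = elts y \<Longrightarrow> x = y"
    and pairing: "\<exists>z. elts z = {x, y}"
    and union: "\<exists>u. elts u = \<Union> (elts ` elts x)"
    and powerset: "\<exists>p. elts p = {y. elts y \<subseteq> elts x}"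
    and separation: "\<exists>y. elts y = {z \<in> elts x. P z}"
    and replacement: "\<exists>y. elts y = f ` elts x"
    and infinity: "\<exists>w. (\<exists>e\<in>elts w. elts e = {}) \<and>
                       (\<forall>x\<in>elts w. \<exists>y\<in>elts w. elts y = insert x (elts x))"
    and foundation: "wf {(x, y). x \<in> elts y}"

definition small :: "'v::zfc_universe set \<Rightarrow> bool" where
  "small X \<longleftrightarrow> (\<exists>x. elts x = X)"


section \<open>Ordinals and cardinals\<close>

text \<open>Von Neumann ordinals: \<open>\<beta> < \<alpha>\<close> is \<open>\<beta> \<in> elts \<alpha>\<close> and the supremum of a set of ordinals is its union.\<close>

definition transitive_set :: "'v::zfc_universe \<Rightarrow> bool" where
  "transitive_set x \<longleftrightarrow> (\<forall>y\<in>elts x. elts y \<subseteq> elts x)"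

definition Ord :: "'v::zfc_universe \<Rightarrow> bool" where
  "Ord \<alpha> \<longleftrightarrow> transitive_set \<alpha> \<and> (\<forall>x\<in>elts \<alpha>. transitive_set x)"

definition ord_le :: "'v::zfc_universe \<Rightarrow> 'v \<Rightarrow> bool" where
  "ord_le \<alpha> \<beta> \<longleftrightarrow> \<alpha> \<in> elts \<beta> \<or> \<alpha> = \<beta>"

definition is_least :: "'v::zfc_universe \<Rightarrow> 'v set \<Rightarrow> bool" where
  "is_least \<mu> C \<longleftrightarrow> \<mu> \<in> C \<and> (\<forall>\<nu>\<in>C. ord_le \<mu> \<nu>)"

definition is_cardinal :: "'v::zfc_universe \<Rightarrow> bool" where
  "is_cardinal \<kappa> \<longleftrightarrow> Ord \<kappa> \<and> (\<forall>\<beta>\<in>elts \<kappa>. \<not> elts \<beta> \<approx> elts \<kappa>)"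

definition infinite_cardinal :: "'v::zfc_universe \<Rightarrow> bool" where
  "infinite_cardinal \<kappa> \<longleftrightarrow> is_cardinal \<kappa> \<and> infinite (elts \<kappa>)"

definition vcard :: "'v::zfc_universe set \<Rightarrow> 'v" where
  "vcard X = (THE \<kappa>. is_cardinal \<kappa> \<and> X \<approx> elts \<kappa>)"

definition ord_relation :: "'v::zfc_universe \<Rightarrow> ('v \<times> 'v) set" where
  "ord_relation \<alpha> = {(\<beta>, \<gamma>). \<beta> \<in> elts \<alpha> \<and> \<gamma> \<in> elts \<alpha> \<and> ord_le \<beta> \<gamma>}"

definition otype :: "('v::zfc_universe \<times> 'v) set \<Rightarrow> 'v" where
  "otype Z = (THE \<alpha>. Ord \<alpha> \<and> (Z, ord_relation \<alpha>) \<in> ordIso)"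


section \<open>The classes of regular cardinals\<close>

definition regulars :: "'v::zfc_universe set" where
  "regulars = {\<kappa>. infinite_cardinal \<kappa> \<and>
     (\<forall>X\<subseteq>elts \<kappa>. (\<forall>\<beta>\<in>elts \<kappa>. \<exists>\<gamma>\<in>X. ord_le \<beta> \<gamma>) \<longrightarrow> X \<approx> elts \<kappa>)}"

text \<open>Closed classes of ordinals contain the suprema of all their nonempty subsets that are sets
  (a class \<open>X\<close> of ordinals whose union is \<open>elts \<gamma>\<close> is automatically small).\<close>

definition closed_class :: "'v::zfc_universe set \<Rightarrow> bool" where
  "closed_class C \<longleftrightarrow> (\<forall>\<gamma>\<in>C. Ord \<gamma>) \<and>
     (\<forall>X \<gamma>. X \<subseteq> C \<and> X \<noteq> {} \<and> elts \<gamma> = \<Union> (elts ` X) \<longrightarrow> \<gamma> \<in> C)"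

definition successor_elements :: "'v::zfc_universe set \<Rightarrow> 'v set" where
  "successor_elements C =
     {\<gamma>\<in>C. \<exists>\<delta>\<in>C. \<delta> \<in> elts \<gamma> \<and> \<not> (\<exists>\<epsilon>\<in>C. \<delta> \<in> elts \<epsilon> \<and> \<epsilon> \<in> elts \<gamma>)}"

function Reg :: "'v::zfc_universe \<Rightarrow> 'v set" where
  "Reg \<alpha> = successor_elements (closed_class hull (regulars - (\<Union>\<beta>\<in>elts \<alpha>. Reg \<beta>)))"
  by auto
termination
  by (relation "{(x, y). x \<in> elts y}") (auto simp: foundation)

declare Reg.simps [simp del]

definition hyperinaccessible :: "'v::zfc_universe \<Rightarrow> bool" where
  "hyperinaccessible \<epsilon> \<longleftrightarrow> is_cardinal \<epsilon> \<and> \<epsilon> \<in> Reg \<epsilon>"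


section \<open>Structures\<close>

text \<open>Function symbols of arity \<open>0\<close> are the constants. Symbols are elements of the universe.\<close>

record 'v vocabulary =
  rel_syms :: "'v set"
  fun_syms :: "'v set"
  arity :: "'v \<Rightarrow> nat"

definition symbols :: "'v vocabulary \<Rightarrow> 'v set" where
  "symbols L = rel_syms L \<union> fun_syms L"

definition is_vocabulary :: "'v::zfc_universe vocabulary \<Rightarrow> bool" where
  "is_vocabulary L \<longleftrightarrow> rel_syms L \<inter> fun_syms L = {} \<and> small (symbols L)"

record 'v struct =
  domain :: "'v set"
  rel_interp :: "'v \<Rightarrow> 'v list set"
  fun_interp :: "'v \<Rightarrow> 'v list \<Rightarrow> 'v"

definition tuples :: "'v set \<Rightarrow> nat \<Rightarrow> 'v list set" where
  "tuples A n = {xs. length xs = n \<and> set xs \<subseteq> A}"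

definition is_structure :: "'v::zfc_universe vocabulary \<Rightarrow> 'v struct \<Rightarrow> bool" where
  "is_structure L M \<longleftrightarrow> small (domain M) \<and> domain M \<noteq> {} \<and>
     (\<forall>r\<in>rel_syms L. rel_interp M r \<subseteq> tuples (domain M) (arity L r)) \<and>
     (\<forall>f\<in>fun_syms L. \<forall>xs\<in>tuples (domain M) (arity L f). fun_interp M f xs \<in> domain M)"

definition substructure :: "'v::zfc_universe vocabulary \<Rightarrow> 'v struct \<Rightarrow> 'v struct \<Rightarrow> bool" where
  "substructure L N M \<longleftrightarrow> is_structure L N \<and> is_structure L M \<and> domain N \<subseteq> domain M \<and>
     (\<forall>r\<in>rel_syms L. rel_interp N r = rel_interp M r \<inter> tuples (domain N) (arity L r)) \<and>
     (\<forall>f\<in>fun_syms L. \<forall>xs\<in>tuples (domain N) (arity L f). fun_interp N f xs = fun_interp M f xs)"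


section \<open>Generalised quantifiers and their logics\<close>

text \<open>A quantifier of type \<open>[n\<^sub>1, \<dots>, n\<^sub>k]\<close> assigns to a domain \<open>A\<close> a class of lists
  \<open>[S\<^sub>1, \<dots>, S\<^sub>k]\<close> with \<open>S\<^sub>i \<subseteq> tuples A n\<^sub>i\<close>.\<close>

record 'v gquantifier =
  gq_type :: "nat list"
  gq_rel :: "'v set \<Rightarrow> 'v list set list set"

datatype 'v tm = Var nat | Fn 'v "'v tm list"

text \<open>In \<open>GQ q [(vs\<^sub>1, \<phi>\<^sub>1), \<dots>, (vs\<^sub>k, \<phi>\<^sub>k)]\<close>, the number \<open>q\<close> is the position of the quantifier in
  the list of additional quantifiers of the language, and \<open>vs\<^sub>i\<close> is the tuple of variables it binds
  in \<open>\<phi>\<^sub>i\<close>.\<close>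

datatype 'v fm =
    Eq "'v tm" "'v tm"
  | Rl 'v "'v tm list"
  | Neg "'v fm"
  | And "'v fm" "'v fm"
  | Ex nat "'v fm"
  | GQ nat "(nat list \<times> 'v fm) list"

fun wf_tm :: "'v vocabulary \<Rightarrow> 'v tm \<Rightarrow> bool" where
  "wf_tm L (Var n) \<longleftrightarrow> True"
| "wf_tm L (Fn f ts) \<longleftrightarrow> f \<in> fun_syms L \<and> length ts = arity L f \<and> (\<forall>t\<in>set ts. wf_tm L t)"

fun wf_fm :: "'v vocabulary \<Rightarrow> 'v gquantifier list \<Rightarrow> 'v fm \<Rightarrow> bool" where
  "wf_fm L Qs (Eq t u) \<longleftrightarrow> wf_tm L t \<and> wf_tm L u"
| "wf_fm L Qs (Rl r ts) \<longleftrightarrow> r \<in> rel_syms L \<and> length ts = arity L r \<and> (\<forall>t\<in>set ts. wf_tm L t)"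
| "wf_fm L Qs (Neg \<phi>) \<longleftrightarrow> wf_fm L Qs \<phi>"
| "wf_fm L Qs (And \<phi> \<psi>) \<longleftrightarrow> wf_fm L Qs \<phi> \<and> wf_fm L Qs \<psi>"
| "wf_fm L Qs (Ex n \<phi>) \<longleftrightarrow> wf_fm L Qs \<phi>"
| "wf_fm L Qs (GQ q bs) \<longleftrightarrow> q < length Qs \<and>
     map (\<lambda>(vs, \<phi>). length vs) bs = gq_type (Qs ! q) \<and>
     (\<forall>(vs, \<phi>)\<in>set bs. distinct vs \<and> wf_fm L Qs \<phi>)"

fun eval_tm :: "'v struct \<Rightarrow> (nat \<Rightarrow> 'v) \<Rightarrow> 'v tm \<Rightarrow> 'v" where
  "eval_tm M a (Var n) = a n"
| "eval_tm M a (Fn f ts) = fun_interp M f (map (eval_tm M a) ts)"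

definition assign :: "(nat \<Rightarrow> 'v) \<Rightarrow> nat list \<Rightarrow> 'v list \<Rightarrow> nat \<Rightarrow> 'v" where
  "assign a vs xs n = (case map_of (zip vs xs) n of None \<Rightarrow> a n | Some x \<Rightarrow> x)"

fun sat :: "'v struct \<Rightarrow> 'v gquantifier list \<Rightarrow> (nat \<Rightarrow> 'v) \<Rightarrow> 'v fm \<Rightarrow> bool" where
  "sat M Qs a (Eq t u) \<longleftrightarrow> eval_tm M a t = eval_tm M a u"
| "sat M Qs a (Rl r ts) \<longleftrightarrow> map (eval_tm M a) ts \<in> rel_interp M r"
| "sat M Qs a (Neg \<phi>) \<longleftrightarrow> \<not> sat M Qs a \<phi>"
| "sat M Qs a (And \<phi> \<psi>) \<longleftrightarrow> sat M Qs a \<phi> \<and> sat M Qs a \<psi>"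
| "sat M Qs a (Ex n \<phi>) \<longleftrightarrow> (\<exists>x\<in>domain M. sat M Qs (a(n := x)) \<phi>)"
| "sat M Qs a (GQ q bs) \<longleftrightarrow>
     map (\<lambda>(vs, \<phi>). {xs \<in> tuples (domain M) (length vs). sat M Qs (assign a vs xs) \<phi>}) bs
       \<in> gq_rel (Qs ! q) (domain M)"

definition elementary_substructure ::
  "'v::zfc_universe vocabulary \<Rightarrow> 'v gquantifier list \<Rightarrow> 'v struct \<Rightarrow> 'v struct \<Rightarrow> bool" where
  "elementary_substructure L Qs N M \<longleftrightarrow> substructure L N M \<and>
     (\<forall>\<phi> a. wf_fm L Qs \<phi> \<and> range a \<subseteq> domain N \<longrightarrow> (sat N Qs a \<phi> \<longleftrightarrow> sat M Qs a \<phi>))"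


section \<open>The quantifiers \<open>I\<close> and \<open>R\<^sup>\<alpha>\<close>\<close>

definition unary :: "'v set \<Rightarrow> 'v list set" where
  "unary X = (\<lambda>x. [x]) ` X"

definition binary :: "('v \<times> 'v) set \<Rightarrow> 'v list set" where
  "binary Z = (\<lambda>(x, y). [x, y]) ` Z"

definition hartig :: "'v gquantifier" where
  "hartig = \<lparr> gq_type = [1, 1],
     gq_rel = (\<lambda>A. {[unary X, unary Y] | X Y. X \<subseteq> A \<and> Y \<subseteq> A \<and> X \<approx> Y}) \<rparr>"

text \<open>\<open>Well_order\<close> refers to reflexive well orders of the field of the relation, which may be
  a proper subset of the domain. Thus every ordinal is an order type, \<open>0\<close> that of the empty
  relation.\<close>

definition reg_quantifier :: "'v::zfc_universe \<Rightarrow> 'v gquantifier" where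
  "reg_quantifier \<alpha> = \<lparr> gq_type = [1, 2],
     gq_rel = (\<lambda>A. {[unary X, binary Z] | X Z. X \<subseteq> A \<and> Z \<subseteq> A \<times> A \<and>
       Well_order Z \<and> otype Z \<in> elts \<alpha> \<and> vcard X \<in> Reg (otype Z)}) \<rparr>"


section \<open>LST numbers\<close>

definition LST_property :: "'v::zfc_universe gquantifier list \<Rightarrow> 'v \<Rightarrow> bool" where
  "LST_property Qs \<kappa> \<longleftrightarrow>
     (\<forall>L M. is_vocabulary L \<and> symbols L \<prec> elts \<kappa> \<and> is_structure L M \<longrightarrow>
       (\<exists>N. elementary_substructure L Qs N M \<and> domain N \<prec> elts \<kappa>))"

text \<open>\<open>is_LST Qs \<kappa>\<close>: the LST number of the quantifiers \<open>Qs\<close> exists and equals \<open>\<kappa>\<close>.\<close>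

definition is_LST :: "'v::zfc_universe gquantifier list \<Rightarrow> 'v \<Rightarrow> bool" where
  "is_LST Qs \<kappa> \<longleftrightarrow> is_least \<kappa> {\<mu>. infinite_cardinal \<mu> \<and> LST_property Qs \<mu>}"

end

theory Submission
  imports Defs
begin

text \<open>
  The lower bound comes from a gap in a small elementary substructure. Let \<open>\<kappa>\<close> be an infinite
  cardinal with the Loewenheim-Skolem-Tarski property. Take the structure with domain
  \<open>A = \<kappa> \<union> {\<kappa>}\<close>, the relation \<open>x \<le> y < z\<close> and finitely many operations, \<open>\<kappa>\<close> being one of them,
  and let \<open>B\<close> be an elementary substructure of size less than \<open>\<kappa>\<close>. Let \<open>\<delta>\<close> be the least ordinal
  missing from \<open>B\<close> and \<open>\<rho>\<close> the least element of \<open>B\<close> above \<open>\<delta>\<close>, so that \<open>B \<inter> \<rho> = \<delta> < \<rho> \<le> \<kappa>\<close>. Whatever an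
  operation produces below \<open>\<rho>\<close> from elements of \<open>B\<close> is therefore below \<open>\<delta>\<close>.

  An ordinal that is not an uncountable regular cardinal carries a function under which no
  large proper initial segment is closed (\<open>not_uncountable_regular_escape\<close>). With these functions
  among the operations, \<open>\<rho>\<close> must be an uncountable regular cardinal.

  Suppose \<open>\<rho> \<in> Reg \<beta>\<close> with \<open>\<beta> < \<alpha>\<close>. The least elements of the classes \<open>Reg \<gamma>\<close>, \<open>\<gamma> \<le> \<beta>\<close>, increase
  strictly with \<open>\<gamma>\<close>, so \<open>\<beta> \<le> \<rho>\<close> (\<open>index_le_Reg_ge\<close>), and equality would make \<open>\<beta>\<close> hyperinaccessible. Hence
  \<open>\<beta> < \<rho>\<close>. Also \<open>\<rho>\<close> has a predecessor \<open>\<sigma>\<close> in the closed class that defines \<open>Reg \<beta>\<close>. If \<open>\<beta>\<close> and \<open>\<sigma>\<close>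
  are values of operations at \<open>\<rho>\<close>, both are below \<open>\<delta>\<close>. The initial segment \<open>\<beta>\<close> is contained in \<open>B\<close>,
  so the quantifier \<open>R\<^sup>\<alpha>\<close> reflects \<open>|\<rho>| \<in> Reg \<beta>\<close> to \<open>|\<delta>| \<in> Reg \<beta>\<close>, and the Haertig quantifier reflects
  \<open>|\<sigma>| \<noteq> |\<rho>|\<close> to \<open>|\<sigma>| \<noteq> |\<delta>|\<close>. So \<open>|\<delta>|\<close> is an element of the closed class strictly between \<open>\<sigma>\<close> and
  \<open>\<rho>\<close>, contradicting the choice of \<open>\<sigma>\<close>.

  Thus \<open>\<rho> \<le> \<kappa>\<close> is an uncountable regular cardinal in none of the classes \<open>Reg \<beta>\<close>, \<open>\<beta> < \<alpha>\<close>
  (\<open>LST_bounds_Reg_ge\<close>). The least element above \<open>\<omega>\<close> of the closed class generated by such cardinals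
  and \<open>\<omega>\<close> is a successor element with predecessor \<open>\<omega>\<close>, hence the first element of \<open>Reg \<alpha>\<close>, and it is
  at most \<open>\<rho>\<close> (\<open>least_Reg\<close>).
\<close>

section \<open>Ordinals\<close>

lemma mem_irrefl: "x \<notin> elts (x::'v::zfc_universe)"
  using wf_not_refl[OF foundation] by fastforce

lemma mem_asym: "x \<in> elts y \<Longrightarrow> (y::'v::zfc_universe) \<notin> elts x"
  using wf_not_sym[OF foundation] by fastforce

lemma mem_induct:
  assumes "\<And>x::'v::zfc_universe. (\<And>y. y \<in> elts x \<Longrightarrow> P y) \<Longrightarrow> P x"
  shows "P a"
  using foundation by (rule wf_induct_rule) (use assms in auto)

lemma Ord_trans: "Ord \<alpha> \<Longrightarrow> \<beta> \<in> elts \<alpha> \<Longrightarrow> \<gamma> \<in> elts \<beta> \<Longrightarrow> \<gamma> \<in> elts \<alpha>"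
  unfolding Ord_def transitive_set_def by blast

lemma Ord_mem: "Ord \<alpha> \<Longrightarrow> \<beta> \<in> elts \<alpha> \<Longrightarrow> Ord \<beta>"
  unfolding Ord_def transitive_set_def by blast

lemma Ord_linear: "Ord \<alpha> \<Longrightarrow> Ord \<beta> \<Longrightarrow> \<alpha> \<in> elts \<beta> \<or> \<alpha> = \<beta> \<or> \<beta> \<in> elts \<alpha>"
proof (induction \<alpha> arbitrary: \<beta> rule: mem_induct)
  case (1 \<alpha>)
  note outer = this
  from \<open>Ord \<beta>\<close> show ?case
  proof (induction \<beta> rule: mem_induct)
    case (1 \<beta>)
    have "elts \<alpha> = elts \<beta>" if "\<alpha> \<notin> elts \<beta>" "\<beta> \<notin> elts \<alpha>"
    proof
      show "elts \<alpha> \<subseteq> elts \<beta>"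
        using outer(1,2) 1(2) that by (metis Ord_mem Ord_trans subsetI)
      show "elts \<beta> \<subseteq> elts \<alpha>"
        using 1 that by (metis Ord_mem Ord_trans subsetI)
    qed
    then show ?case
      using extensionality by blast
  qed
qed

lemma ord_leD: "ord_le \<alpha> \<beta> \<Longrightarrow> \<beta> \<notin> elts \<alpha>"
  unfolding ord_le_def using mem_asym mem_irrefl by auto

lemma ord_leI: "Ord \<alpha> \<Longrightarrow> Ord \<beta> \<Longrightarrow> \<beta> \<notin> elts \<alpha> \<Longrightarrow> ord_le \<alpha> \<beta>"
  unfolding ord_le_def using Ord_linear by auto

lemma ord_le_mem_trans: "Ord \<gamma> \<Longrightarrow> ord_le \<alpha> \<beta> \<Longrightarrow> \<beta> \<in> elts \<gamma> \<Longrightarrow> \<alpha> \<in> elts \<gamma>"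
  unfolding ord_le_def using Ord_trans by auto

lemma ord_le_trans: "Ord \<gamma> \<Longrightarrow> ord_le \<alpha> \<beta> \<Longrightarrow> ord_le \<beta> \<gamma> \<Longrightarrow> ord_le \<alpha> \<gamma>"
  using Ord_trans unfolding ord_le_def by auto

lemma Ord_subset: "Ord \<alpha> \<Longrightarrow> \<beta> \<in> elts \<alpha> \<Longrightarrow> elts \<beta> \<subseteq> elts \<alpha>"
  using Ord_trans by auto

lemma ord_le_subset: "Ord \<beta> \<Longrightarrow> ord_le \<alpha> \<beta> \<Longrightarrow> elts \<alpha> \<subseteq> elts \<beta>"
  unfolding ord_le_def using Ord_subset by auto

lemma subset_ord_le:
  assumes "Ord \<alpha>" "Ord \<beta>" "elts \<alpha> \<subseteq> elts \<beta>"
  shows "ord_le \<alpha> \<beta>"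
  using ord_leI[OF assms(1,2)] assms(3) mem_irrefl by auto

lemma is_least_exists:
  assumes "\<And>\<gamma>. \<gamma> \<in> C \<Longrightarrow> Ord \<gamma>" "C \<noteq> {}"
  obtains \<mu> where "is_least \<mu> C"
proof -
  have "\<exists>z\<in>C. \<forall>y. (y, z) \<in> {(x, y). x \<in> elts y} \<longrightarrow> y \<notin> C"
    using foundation[unfolded wf_eq_minimal] assms(2) by blast
  then obtain \<mu> where mu: "\<mu> \<in> C" "\<And>y. y \<in> elts \<mu> \<Longrightarrow> y \<notin> C"
    by auto
  have "ord_le \<mu> \<nu>" if "\<nu> \<in> C" for \<nu>
    using ord_leI[OF assms(1)[OF mu(1)] assms(1)[OF that]] mu(2)[of \<nu>] that by blast
  then show thesis
    using that mu(1) unfolding is_least_def by blast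
qed

lemma Ord_Union:
  assumes "\<And>\<beta>. \<beta> \<in> X \<Longrightarrow> Ord \<beta>" "elts \<gamma> = \<Union> (elts ` X)"
  shows "Ord \<gamma>"
  unfolding Ord_def transitive_set_def
proof (intro conjI ballI)
  fix y assume "y \<in> elts \<gamma>"
  then obtain \<beta> where b: "\<beta> \<in> X" "y \<in> elts \<beta>" using assms(2) by auto
  show "elts y \<subseteq> elts \<gamma>"
    using b assms(2) Ord_subset[OF assms(1)[OF b(1)] b(2)] by auto
  fix z assume "z \<in> elts y"
  then show "elts z \<subseteq> elts y"
    using Ord_subset[OF Ord_mem[OF assms(1)[OF b(1)] b(2)]] by simp
qed

lemma finite_Ord_max:
  assumes "Ord \<delta>" "finite (elts \<delta>)" "elts \<delta> \<noteq> {}"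
  shows "\<exists>m\<in>elts \<delta>. \<forall>x\<in>elts \<delta>. ord_le x m"
proof -
  have "\<exists>m\<in>S. \<forall>x\<in>S. ord_le x m" if "finite S" "S \<noteq> {}" "S \<subseteq> elts \<delta>" for S
    using that
  proof (induction S rule: finite_ne_induct)
    case (insert a S)
    then obtain m where m: "m \<in> S" "\<forall>x\<in>S. ord_le x m" by blast
    have o: "Ord a" "Ord m" using insert.prems m assms(1) Ord_mem by blast+
    show ?case
    proof (cases "ord_le a m")
      case True then show ?thesis using m by blast
    next
      case False
      then have "m \<in> elts a" using ord_leI[OF o] by blast
      then have "\<forall>x\<in>insert a S. ord_le x a"
        using m ord_le_mem_trans[OF o(1)] unfolding ord_le_def by fast
      then show ?thesis by blast
    qed
  qed (simp add: ord_le_def)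
  then show ?thesis using assms by blast
qed

section \<open>Cardinals and order types\<close>

lemma cardinal_eqpoll_eq:
  assumes "is_cardinal \<kappa>" "is_cardinal \<mu>" "elts \<kappa> \<approx> elts \<mu>"
  shows "\<kappa> = \<mu>"
proof -
  have "\<kappa> \<notin> elts \<mu>" "\<mu> \<notin> elts \<kappa>" "Ord \<kappa>" "Ord \<mu>"
    using assms eqpoll_sym[OF assms(3)] unfolding is_cardinal_def by auto
  then show ?thesis using Ord_linear by auto
qed

lemma vcard_Ord:
  fixes \<delta> :: "'v::zfc_universe"
  assumes "Ord \<delta>"
  shows "is_cardinal (vcard (elts \<delta>))" "elts \<delta> \<approx> elts (vcard (elts \<delta>))"
    "ord_le (vcard (elts \<delta>)) \<delta>"
proof -
  obtain \<tau> :: 'v where t: "is_least \<tau> {\<tau>. Ord \<tau> \<and> elts \<delta> \<approx> elts \<tau>}"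
  proof (rule is_least_exists)
    show "{\<tau>::'v. Ord \<tau> \<and> elts \<delta> \<approx> elts \<tau>} \<noteq> {}"
      using assms eqpoll_refl[of "elts \<delta>"] by auto
  qed auto
  have c: "is_cardinal \<tau>"
    unfolding is_cardinal_def
  proof (intro conjI ballI notI)
    show "Ord \<tau>" using t unfolding is_least_def by blast
    fix \<beta> assume "\<beta> \<in> elts \<tau>" "elts \<beta> \<approx> elts \<tau>"
    moreover have "elts \<delta> \<approx> elts \<tau>" "Ord \<tau>" using t unfolding is_least_def by auto
    ultimately have "elts \<delta> \<approx> elts \<beta>" "Ord \<beta>"
      using eqpoll_trans[OF _ eqpoll_sym] Ord_mem by auto
    then have "ord_le \<tau> \<beta>"
      using t unfolding is_least_def by simp
    then show False
      using \<open>\<beta> \<in> elts \<tau>\<close> ord_leD by blast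
  qed
  have e: "elts \<delta> \<approx> elts \<tau>" using t unfolding is_least_def by blast
  have "vcard (elts \<delta>) = \<tau>"
    unfolding vcard_def
  proof (rule the_equality)
    fix \<mu> :: 'v assume "is_cardinal \<mu> \<and> elts \<delta> \<approx> elts \<mu>"
    then show "\<mu> = \<tau>"
      using cardinal_eqpoll_eq[OF _ c] eqpoll_trans[OF eqpoll_sym e] by blast
  qed (use c e in blast)
  then show "is_cardinal (vcard (elts \<delta>))" "elts \<delta> \<approx> elts (vcard (elts \<delta>))"
    "ord_le (vcard (elts \<delta>)) \<delta>"
    using c e t assms unfolding is_least_def by auto
qed

lemma vcard_cardinal:
  assumes "is_cardinal \<kappa>"
  shows "vcard (elts \<kappa>) = \<kappa>"
proof -
  have "Ord \<kappa>" using assms unfolding is_cardinal_def by blast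
  from cardinal_eqpoll_eq[OF assms vcard_Ord(1,2)[OF this]] show ?thesis by (rule sym)
qed

lemma Field_ord_relation: "Field (ord_relation \<alpha>) = elts \<alpha>"
  unfolding Field_def ord_relation_def ord_le_def by auto

lemma Well_order_ord_relation:
  assumes "Ord \<alpha>"
  shows "Well_order (ord_relation \<alpha>)"
proof -
  have ord: "\<And>x. x \<in> elts \<alpha> \<Longrightarrow> Ord x" using assms Ord_mem by blast
  have "Refl (ord_relation \<alpha>)"
    unfolding refl_on_def Field_ord_relation by (auto simp: ord_relation_def ord_le_def)
  moreover have "trans (ord_relation \<alpha>)"
    by (rule transI) (use ord ord_le_trans in \<open>auto simp: ord_relation_def\<close>)
  moreover have "antisym (ord_relation \<alpha>)"
    by (rule antisymI) (use mem_asym in \<open>auto simp: ord_relation_def ord_le_def\<close>)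
  moreover have "Total (ord_relation \<alpha>)"
    unfolding total_on_def Field_ord_relation
    using Ord_linear[OF ord ord] by (auto simp: ord_relation_def ord_le_def)
  moreover have "wf (ord_relation \<alpha> - Id)"
    by (rule wf_subset[OF foundation]) (auto simp: ord_relation_def ord_le_def)
  moreover have "ord_relation \<alpha> \<subseteq> Field (ord_relation \<alpha>) \<times> Field (ord_relation \<alpha>)"
    unfolding Field_def by force
  ultimately show ?thesis
    unfolding well_order_on_def linear_order_on_def partial_order_on_def preorder_on_def
    by blast
qed

lemma Restr_underS_ord_relation:
  assumes "Ord \<beta>" "\<alpha> \<in> elts \<beta>"
  shows "Restr (ord_relation \<beta>) (underS (ord_relation \<beta>) \<alpha>) = ord_relation \<alpha>"
proof -
  have "underS (ord_relation \<beta>) \<alpha> = elts \<alpha>"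
    using assms Ord_trans[OF assms] mem_irrefl[of \<alpha>]
    unfolding underS_def ord_relation_def ord_le_def by auto
  then show ?thesis
    using Ord_trans[OF assms] unfolding ord_relation_def by auto
qed

lemma ord_relation_ordLess:
  assumes "Ord \<beta>" "\<alpha> \<in> elts \<beta>"
  shows "(ord_relation \<alpha>, ord_relation \<beta>) \<in> ordLess"
  using underS_Restr_ordLess[OF Well_order_ord_relation[OF assms(1)], of \<alpha>] assms
  by (auto simp: Field_ord_relation Restr_underS_ord_relation)

lemma otype_ord_relation:
  fixes \<alpha> :: "'v::zfc_universe"
  assumes "Ord \<alpha>"
  shows "otype (ord_relation \<alpha>) = \<alpha>"
  unfolding otype_def
proof (rule the_equality)
  show "Ord \<alpha> \<and> (ord_relation \<alpha>, ord_relation \<alpha>) \<in> ordIso"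
    using assms ordIso_reflexive[OF Well_order_ord_relation[OF assms]] by simp
  fix \<beta> :: 'v assume b: "Ord \<beta> \<and> (ord_relation \<alpha>, ord_relation \<beta>) \<in> ordIso"
  show "\<beta> = \<alpha>"
    using Ord_linear[of \<alpha> \<beta>] assms b ord_relation_ordLess[of \<beta> \<alpha>] ord_relation_ordLess[of \<alpha> \<beta>]
      not_ordLess_ordIso ordIso_symmetric by metis
qed

text \<open>The cardinality of \<open>X\<close> as an abstract well order is at most that of \<open>\<rho>\<close>, hence isomorphic to
  an initial segment of \<open>\<rho>\<close>, and initial segments are ordinals.\<close>

lemma subset_Ord_eqpoll:
  assumes "Ord \<rho>" "X \<subseteq> elts \<rho>"
  obtains \<theta> where "ord_le \<theta> \<rho>" "X \<approx> elts \<theta>"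
proof -
  let ?r = "ord_relation \<rho>"
  have wo: "Well_order ?r" using assms(1) Well_order_ord_relation by blast
  have "(card_of X, card_of (elts \<rho>)) \<in> ordLeq"
    using assms(2) by (rule card_of_mono1)
  then have "(card_of X, ?r) \<in> ordLeq"
    using card_of_least[of "elts \<rho>" ?r] wo ordLeq_transitive by (metis Field_ord_relation)
  then consider "(card_of X, ?r) \<in> ordLess" | "(card_of X, ?r) \<in> ordIso"
    using ordLeq_iff_ordLess_or_ordIso by blast
  then have "\<exists>\<theta>. ord_le \<theta> \<rho> \<and> (card_of X, ord_relation \<theta>) \<in> ordIso"
  proof cases
    case 1
    then obtain a where a: "a \<in> elts \<rho>" "(card_of X, Restr ?r (underS ?r a)) \<in> ordIso"
      using ordLess_iff_ordIso_Restr[OF wo card_of_Well_order[of X]] by (auto simp: Field_ord_relation)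
    then show ?thesis
      using Restr_underS_ord_relation[OF assms(1)] unfolding ord_le_def by metis
  qed (auto simp: ord_le_def)
  then obtain \<theta> f where "ord_le \<theta> \<rho>" "iso (card_of X) (ord_relation \<theta>) f"
    unfolding ordIso_def by blast
  then have "X \<approx> elts \<theta>"
    unfolding iso_def eqpoll_def by (auto simp: Field_ord_relation Field_card_of)
  then show thesis using that \<open>ord_le \<theta> \<rho>\<close> by blast
qed

section \<open>The least infinite ordinal and the classes of regular cardinals\<close>

text \<open>A predicate rather than a constant: minimality characterises \<open>\<omega>\<close>, and its existence
  follows from that of any infinite ordinal, such as the cardinal \<open>\<kappa>\<close> of the theorem.\<close>

definition is_omega :: "'v::zfc_universe \<Rightarrow> bool" where
  "is_omega \<omega> \<longleftrightarrow> is_least \<omega> {\<gamma>. Ord \<gamma> \<and> infinite (elts \<gamma>)}"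

definition Reg_ge :: "'v::zfc_universe \<Rightarrow> 'v set" where
  "Reg_ge \<alpha> = regulars - (\<Union>\<beta>\<in>elts \<alpha>. Reg \<beta>)"

lemma is_omegaD:
  assumes "is_omega \<omega>"
  shows "Ord \<omega>" "infinite (elts \<omega>)" "n \<in> elts \<omega> \<Longrightarrow> finite (elts n)"
    "Ord \<gamma> \<Longrightarrow> infinite (elts \<gamma>) \<Longrightarrow> ord_le \<omega> \<gamma>"
proof -
  show o: "Ord \<omega>" "infinite (elts \<omega>)" and
    l: "Ord \<gamma> \<Longrightarrow> infinite (elts \<gamma>) \<Longrightarrow> ord_le \<omega> \<gamma>" for \<gamma>
    using assms unfolding is_omega_def is_least_def by auto
  show "n \<in> elts \<omega> \<Longrightarrow> finite (elts n)"
    using l[of n] o ord_leD[of \<omega> n] Ord_mem[of \<omega> n] by auto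
qed

lemma omega_regular:
  assumes "is_omega \<omega>"
  shows "\<omega> \<in> regulars"
proof -
  note w = is_omegaD[OF assms]
  have "\<not> elts n \<approx> elts \<omega>" if "n \<in> elts \<omega>" for n
    using w that eqpoll_finite_iff by blast
  then have "infinite_cardinal \<omega>"
    unfolding infinite_cardinal_def is_cardinal_def using w by blast
  moreover have "X \<approx> elts \<omega>"
    if X: "X \<subseteq> elts \<omega>" "\<forall>\<beta>\<in>elts \<omega>. \<exists>\<gamma>\<in>X. ord_le \<beta> \<gamma>" for X
  proof -
    have "infinite X"
    proof
      assume "finite X"
      moreover have "elts \<omega> \<subseteq> (\<Union>\<gamma>\<in>X. insert \<gamma> (elts \<gamma>))"
        using X unfolding ord_le_def by blast
      ultimately show False
        using w X(1) by (meson finite_UN finite_insert finite_subset subsetD)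
    qed
    \<comment> \<open>\<open>X\<close> contains a copy of the type of natural numbers, and the cardinality of a finite
        ordinal embeds \<open>\<omega>\<close> into that type.\<close>
    then have "(UNIV::nat set) \<lesssim> X"
      by (simp add: infinite_le_lepoll)
    moreover have "inj_on (\<lambda>n. card (elts n)) (elts \<omega>)"
    proof (rule inj_onI)
      fix m n assume mn: "m \<in> elts \<omega>" "n \<in> elts \<omega>" "card (elts m) = card (elts n)"
      have "card (elts i) < card (elts j)" if "i \<in> elts j" "j \<in> elts \<omega>" for i j
        using Ord_subset[OF Ord_mem[OF w(1) that(2)] that(1)] that mem_irrefl[of i] w(3)[OF that(2)]
        by (metis psubset_card_mono psubsetI)
      then show "m = n"
        using mn Ord_linear[OF Ord_mem[OF w(1) mn(1)] Ord_mem[OF w(1) mn(2)]]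
        by (metis less_irrefl)
    qed
    then have "elts \<omega> \<lesssim> (UNIV::nat set)"
      unfolding lepoll_def by blast
    ultimately show ?thesis
      using subset_imp_lepoll[OF X(1)] by (meson lepoll_antisym lepoll_trans)
  qed
  ultimately show ?thesis
    unfolding regulars_def by blast
qed

lemma Reg_eq: "Reg \<alpha> = successor_elements (closed_class hull Reg_ge \<alpha>)"
  unfolding Reg_ge_def by (rule Reg.simps)

lemma Ord_regular: "\<rho> \<in> regulars \<Longrightarrow> Ord \<rho> \<and> infinite (elts \<rho>)"
  unfolding regulars_def infinite_cardinal_def is_cardinal_def by blast

lemma closed_classI:
  assumes "\<And>\<gamma>. \<gamma> \<in> C \<Longrightarrow> Ord \<gamma>"
    and "\<And>X \<gamma>. X \<subseteq> C \<Longrightarrow> X \<noteq> {} \<Longrightarrow> elts \<gamma> = \<Union> (elts ` X) \<Longrightarrow> \<gamma> \<in> C"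
  shows "closed_class C"
  unfolding closed_class_def using assms by blast

lemma closed_classD:
  assumes "closed_class C" "X \<subseteq> C" "X \<noteq> {}" "elts \<gamma> = \<Union> (elts ` X)"
  shows "\<gamma> \<in> C"
  using assms unfolding closed_class_def by blast

lemma closed_class_infinite_ordinals:
  "closed_class {\<gamma>. Ord \<gamma> \<and> infinite (elts \<gamma>)}"
proof (rule closed_classI)
  fix X \<gamma> assume "X \<subseteq> {\<gamma>. Ord \<gamma> \<and> infinite (elts \<gamma>)}" "X \<noteq> {}" "elts \<gamma> = \<Union> (elts ` X)"
  then show "\<gamma> \<in> {\<gamma>. Ord \<gamma> \<and> infinite (elts \<gamma>)}"
    using Ord_Union[of X \<gamma>] by (auto dest: finite_subset[rotated])
qed auto

lemma hull_infinite_ordinals: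
  assumes "S \<subseteq> regulars" "\<gamma> \<in> closed_class hull S"
  shows "Ord \<gamma>" "infinite (elts \<gamma>)"
proof -
  have "closed_class hull S \<subseteq> {\<gamma>. Ord \<gamma> \<and> infinite (elts \<gamma>)}"
    using assms(1) Ord_regular closed_class_infinite_ordinals by (intro hull_minimal) auto
  then show "Ord \<gamma>" "infinite (elts \<gamma>)" using assms(2) by auto
qed

text \<open>Closedness passes to intersections except that of the empty family, which is the whole
  universe and contains sets that are not ordinals. The class of infinite ordinals is closed and
  contains \<open>S\<close>, so the family here is not empty.\<close>

lemma closed_class_hull:
  assumes "S \<subseteq> regulars"
  shows "closed_class (closed_class hull S)"
proof (rule closed_classI)
  fix X \<gamma> assume X: "X \<subseteq> closed_class hull S" "X \<noteq> {}" "elts \<gamma> = \<Union> (elts ` X)"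
  show "\<gamma> \<in> closed_class hull S"
    unfolding hull_def
  proof (rule InterI)
    fix T assume "T \<in> {T. closed_class T \<and> S \<subseteq> T}"
    then have "closed_class T" "S \<subseteq> T" by auto
    moreover from this have "X \<subseteq> T"
      using X(1) hull_minimal[of S T closed_class] by blast
    ultimately show "\<gamma> \<in> T"
      using X closed_classD by blast
  qed
qed (use hull_infinite_ordinals assms in blast)

text \<open>A successor element is not a supremum of smaller elements, since these are bounded by its
  predecessor. So removing it from the hull leaves a closed class, which would contradict
  minimality of the hull unless the removed element is a generator.\<close>

lemma successor_elements_hull:
  assumes "S \<subseteq> regulars"
  shows "successor_elements (closed_class hull S) \<subseteq> S"
proof
  let ?C = "closed_class hull S"
  fix \<gamma> assume "\<gamma> \<in> successor_elements ?C"
  then obtain \<delta> where g: "\<gamma> \<in> ?C" "\<delta> \<in> ?C" "\<delta> \<in> elts \<gamma>"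
    and pred: "\<And>\<epsilon>. \<epsilon> \<in> ?C \<Longrightarrow> \<delta> \<in> elts \<epsilon> \<Longrightarrow> \<epsilon> \<notin> elts \<gamma>"
    unfolding successor_elements_def by blast
  note ord = hull_infinite_ordinals(1)[OF assms]
  show "\<gamma> \<in> S"
  proof (rule ccontr)
    assume "\<gamma> \<notin> S"
    have "closed_class (?C - {\<gamma>})"
    proof (rule closed_classI)
      fix X \<eta> assume X: "X \<subseteq> ?C - {\<gamma>}" "X \<noteq> {}" "elts \<eta> = \<Union> (elts ` X)"
      then have "\<eta> \<in> ?C"
        using closed_classD[OF closed_class_hull[OF assms], of X \<eta>] by blast
      moreover have "\<eta> \<noteq> \<gamma>"
      proof
        assume "\<eta> = \<gamma>"
        have "elts \<xi> \<subseteq> elts \<delta>" if "\<xi> \<in> X" for \<xi>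
        proof -
          have xi: "\<xi> \<in> ?C" "\<xi> \<noteq> \<gamma>" "elts \<xi> \<subseteq> elts \<gamma>"
            using that X \<open>\<eta> = \<gamma>\<close> by auto
          then have "\<xi> \<in> elts \<gamma>"
            using subset_ord_le[OF ord ord, of \<xi> \<gamma>] g(1) unfolding ord_le_def by blast
          then have "\<delta> \<notin> elts \<xi>"
            using pred xi(1) by blast
          then show ?thesis
            using ord_le_subset[OF ord[OF g(2)] ord_leI[OF ord[OF xi(1)] ord[OF g(2)]]] by blast
        qed
        then have "\<delta> \<in> elts \<delta>"
          using g(3) X \<open>\<eta> = \<gamma>\<close> by blast
        then show False using mem_irrefl by blast
      qed
      ultimately show "\<eta> \<in> ?C - {\<gamma>}" by blast
    qed (use ord in blast)
    then have "?C \<subseteq> ?C - {\<gamma>}"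
      using \<open>\<gamma> \<notin> S\<close> hull_subset[of S closed_class] by (intro hull_minimal) auto
    then show False using g(1) by blast
  qed
qed

lemma Reg_ge_subset: "Reg_ge \<alpha> \<subseteq> regulars"
  unfolding Reg_ge_def by blast

lemma Reg_subset_Reg_ge: "Reg \<alpha> \<subseteq> Reg_ge \<alpha>"
  unfolding Reg_eq using successor_elements_hull[OF Reg_ge_subset] .

text \<open>Every element of \<open>Reg \<alpha>\<close> is above its predecessor in a class of infinite ordinals. Consequently
  \<open>\<omega>\<close> is never removed from the generating class and is the least element of every hull.\<close>

lemma omega_less_Reg:
  assumes "is_omega \<omega>" "\<rho> \<in> Reg \<alpha>"
  shows "\<omega> \<in> elts \<rho>"
proof -
  let ?C = "closed_class hull Reg_ge \<alpha>"
  obtain \<delta> where d: "\<delta> \<in> ?C" "\<delta> \<in> elts \<rho>" "\<rho> \<in> ?C"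
    using assms(2) unfolding Reg_eq successor_elements_def by blast
  note inf_ord = hull_infinite_ordinals[OF Reg_ge_subset]
  have "ord_le \<omega> \<delta>"
    using is_omegaD(4)[OF assms(1)] inf_ord[OF d(1)] by simp
  then show ?thesis
    using ord_le_mem_trans[OF inf_ord(1)[OF d(3)] _ d(2)] by simp
qed

lemma omega_Reg_ge: "is_omega \<omega> \<Longrightarrow> \<omega> \<in> Reg_ge \<alpha>"
  unfolding Reg_ge_def using omega_regular omega_less_Reg mem_irrefl by blast

text \<open>The least element of the hull above \<open>\<omega>\<close> has \<open>\<omega>\<close> as its immediate predecessor, so it is a
  successor element.\<close>

lemma least_Reg:
  assumes w: "is_omega \<omega>" and r: "\<rho> \<in> closed_class hull Reg_ge \<alpha>" "\<omega> \<in> elts \<rho>"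
  shows "\<exists>\<mu>. is_least \<mu> (Reg \<alpha>) \<and> ord_le \<mu> \<rho>"
proof -
  let ?C = "closed_class hull Reg_ge \<alpha>"
  note ord = hull_infinite_ordinals(1)[OF Reg_ge_subset]
  obtain \<mu> where mu: "is_least \<mu> {\<gamma> \<in> ?C. \<omega> \<in> elts \<gamma>}"
    using is_least_exists[of "{\<gamma> \<in> ?C. \<omega> \<in> elts \<gamma>}"] r ord by blast
  have C: "\<omega> \<in> ?C" "\<mu> \<in> ?C"
    using omega_Reg_ge[OF w] hull_subset[of "Reg_ge \<alpha>" closed_class] mu
    unfolding is_least_def by auto
  have "\<mu> \<in> Reg \<alpha>"
    unfolding Reg_eq successor_elements_def
  proof (intro CollectI conjI bexI[of _ \<omega>] notI)
    assume "\<exists>\<epsilon>\<in>?C. \<omega> \<in> elts \<epsilon> \<and> \<epsilon> \<in> elts \<mu>"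
    then show False
      using mu ord_leD unfolding is_least_def by blast
  qed (use C mu in \<open>auto simp: is_least_def\<close>)
  moreover have "ord_le \<mu> \<nu>" if "\<nu> \<in> Reg \<alpha>" for \<nu>
    using mu omega_less_Reg[OF w that] that
    unfolding is_least_def Reg_eq successor_elements_def by blast
  ultimately show ?thesis
    using mu r by (auto simp: is_least_def)
qed

text \<open>For \<open>\<gamma> < \<beta>\<close>, the cardinal \<open>\<rho>\<close> is an element of the closed class of stage \<open>\<gamma>\<close> but no successor
  element of it; so \<open>\<omega>\<close> is not its predecessor there, and the least element \<open>\<mu>\<close> of \<open>Reg \<gamma>\<close> is below
  \<open>\<rho>\<close>. By induction \<open>\<gamma> \<le> \<mu> < \<rho>\<close>.\<close>

lemma index_le_Reg_ge:
  assumes w: "is_omega \<omega>"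
  shows "Ord \<beta> \<Longrightarrow> \<rho> \<in> Reg_ge \<beta> \<Longrightarrow> \<omega> \<in> elts \<rho> \<Longrightarrow> ord_le \<beta> \<rho>"
proof (induction \<beta> arbitrary: \<rho> rule: mem_induct)
  case (1 \<beta>)
  have ord: "Ord \<rho>" using 1(3) Reg_ge_subset Ord_regular by blast
  have "\<gamma> \<in> elts \<rho>" if g: "\<gamma> \<in> elts \<beta>" for \<gamma>
  proof -
    let ?C = "closed_class hull Reg_ge \<gamma>"
    have "\<rho> \<in> Reg_ge \<gamma>" "\<rho> \<notin> Reg \<gamma>"
      using 1(3) g Ord_trans[OF 1(2) g] unfolding Reg_ge_def by auto
    then have C: "\<rho> \<in> ?C" "\<omega> \<in> ?C"
      using omega_Reg_ge[OF w] hull_subset[of "Reg_ge \<gamma>" closed_class] by auto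
    then obtain \<epsilon> where e: "\<epsilon> \<in> ?C" "\<omega> \<in> elts \<epsilon>" "\<epsilon> \<in> elts \<rho>"
      using \<open>\<rho> \<notin> Reg \<gamma>\<close> 1(4) unfolding Reg_eq successor_elements_def by blast
    obtain \<mu> where mu: "\<mu> \<in> Reg \<gamma>" "ord_le \<mu> \<epsilon>"
      using least_Reg[OF w e(1,2)] unfolding is_least_def by blast
    have "\<mu> \<in> Reg_ge \<gamma>" "\<omega> \<in> elts \<mu>"
      using mu(1) Reg_subset_Reg_ge omega_less_Reg[OF w] by blast+
    then have "ord_le \<gamma> \<mu>"
      using 1(1)[OF g] Ord_mem[OF 1(2) g] by blast
    moreover have "\<mu> \<in> elts \<rho>"
      using ord_le_mem_trans[OF ord mu(2) e(3)] .
    ultimately show ?thesis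
      using ord_le_mem_trans[OF ord] by blast
  qed
  then show ?case
    using subset_ord_le[OF 1(2) ord] by blast
qed

section \<open>Uncountable regularity and closed initial segments\<close>

text \<open>One half of a characterisation: a nonzero ordinal \<open>\<rho>\<close> is a regular uncountable cardinal iff for
  every function \<open>g\<close> from \<open>\<rho>\<close> to \<open>\<rho>\<close> and every \<open>\<theta> < \<rho>\<close> some \<open>\<delta>\<close> with \<open>\<theta> < \<delta> < \<rho>\<close> is closed under \<open>g\<close>. If \<open>\<rho>\<close>
  is singular or not a cardinal, then \<open>g\<close> maps some \<open>\<theta> < \<rho>\<close> onto a cofinal subset; if \<open>\<rho> = \<omega>\<close>, then
  \<open>g\<close> moves every number upwards; and if \<open>\<rho>\<close> is finite, then its maximum \<open>\<theta>\<close> leaves no room for \<open>\<delta>\<close>.\<close>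

lemma not_uncountable_regular_escape:
  assumes w: "is_omega \<omega>" and ord: "Ord \<rho>" "elts \<rho> \<noteq> {}"
    and nreg: "\<not> (\<rho> \<in> regulars \<and> \<omega> \<in> elts \<rho>)"
  shows "\<exists>\<theta> g. \<theta> \<in> elts \<rho> \<and> (\<forall>\<delta>\<in>elts \<rho>. \<theta> \<in> elts \<delta> \<longrightarrow> (\<exists>\<xi>\<in>elts \<delta>. g \<xi> \<in> elts \<rho> - elts \<delta>))"
proof -
  note om = is_omegaD[OF w]
  \<comment> \<open>An ordinal \<open>\<delta>\<close> above \<open>\<theta>\<close> contains all arguments of \<open>g\<close>, so closure under \<open>g\<close> would make the
      cofinal set \<open>X\<close> a subset of \<open>\<delta>\<close>.\<close>
  have escape: ?thesis if cofinal: "\<theta> \<in> elts \<rho>" "X \<approx> elts \<theta>" "X \<subseteq> elts \<rho>"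
    "\<forall>\<beta>\<in>elts \<rho>. \<exists>\<gamma>\<in>X. ord_le \<beta> \<gamma>" for X \<theta>
  proof -
    obtain g where g: "g ` elts \<theta> = X"
      using cofinal(2) by (meson bij_betw_def eqpoll_def eqpoll_sym)
    have "\<exists>\<xi>\<in>elts \<delta>. g \<xi> \<in> elts \<rho> - elts \<delta>" if d: "\<delta> \<in> elts \<rho>" "\<theta> \<in> elts \<delta>" for \<delta>
    proof -
      obtain \<xi> where "\<xi> \<in> elts \<theta>" "ord_le \<delta> (g \<xi>)" "g \<xi> \<in> elts \<rho>"
        using \<open>\<forall>\<beta>\<in>elts \<rho>. \<exists>\<gamma>\<in>X. ord_le \<beta> \<gamma>\<close> \<open>X \<subseteq> elts \<rho>\<close> d(1) g by blast
      then show ?thesis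
        using Ord_subset[OF Ord_mem[OF ord(1) d(1)] d(2)] ord_leD[of \<delta> "g \<xi>"] by blast
    qed
    then show ?thesis using cofinal(1) by blast
  qed
  consider "finite (elts \<rho>)" | "infinite (elts \<rho>)" "\<not> is_cardinal \<rho>"
    | "infinite (elts \<rho>)" "is_cardinal \<rho>" "\<rho> \<notin> regulars" | "\<rho> = \<omega>"
    using nreg om(4)[of \<rho>] ord unfolding ord_le_def by blast
  then show ?thesis
  proof cases
    case 1
    then obtain m where "m \<in> elts \<rho>" "\<forall>x\<in>elts \<rho>. ord_le x m" using finite_Ord_max ord by blast
    then have "\<forall>\<delta>\<in>elts \<rho>. m \<notin> elts \<delta>"
      using ord_leD by blast
    then show ?thesis
      using \<open>m \<in> elts \<rho>\<close> by blast
  next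
    case 2
    then obtain \<theta> where "\<theta> \<in> elts \<rho>" "elts \<theta> \<approx> elts \<rho>"
      using ord unfolding is_cardinal_def by blast
    then show ?thesis
      using escape[of \<theta> "elts \<rho>"] eqpoll_sym unfolding ord_le_def by blast
  next
    case 3
    then obtain X where X: "X \<subseteq> elts \<rho>" "\<forall>\<beta>\<in>elts \<rho>. \<exists>\<gamma>\<in>X. ord_le \<beta> \<gamma>" "\<not> X \<approx> elts \<rho>"
      unfolding regulars_def infinite_cardinal_def by blast
    then obtain \<theta> where "ord_le \<theta> \<rho>" "X \<approx> elts \<theta>"
      using subset_Ord_eqpoll ord by blast
    then show ?thesis
      using escape[of \<theta> X] X unfolding ord_le_def by blast
  next
    case 4
    have "\<exists>s\<in>elts \<rho>. \<xi> \<in> elts s" if "\<xi> \<in> elts \<rho>" for \<xi>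
    proof (rule ccontr)
      assume "\<not> ?thesis"
      then have "elts \<rho> \<subseteq> insert \<xi> (elts \<xi>)"
        using Ord_mem[OF ord(1)] Ord_linear that by blast
      then show False
        using om(2) om(3)[of \<xi>] 4 that finite_subset by blast
    qed
    then obtain g where g: "\<And>\<xi>. \<xi> \<in> elts \<rho> \<Longrightarrow> g \<xi> \<in> elts \<rho> \<and> \<xi> \<in> elts (g \<xi>)"
      by metis
    obtain \<theta> where "\<theta> \<in> elts \<rho>" using ord by blast
    moreover have "\<exists>\<xi>\<in>elts \<delta>. g \<xi> \<in> elts \<rho> - elts \<delta>" if d: "\<delta> \<in> elts \<rho>" "\<theta> \<in> elts \<delta>" for \<delta>
    proof -
      have o: "Ord \<delta>" using d Ord_mem ord by blast
      obtain m where m: "m \<in> elts \<delta>" "\<forall>x\<in>elts \<delta>. ord_le x m"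
        using finite_Ord_max[OF o] d om(3) 4 by blast
      have "m \<in> elts \<rho>" using Ord_trans[OF ord(1) d(1) m(1)] .
      then have "g m \<notin> elts \<delta>"
        using g[of m] m(2) ord_leD[of "g m" m] by blast
      then show ?thesis using g m \<open>m \<in> elts \<rho>\<close> by blast
    qed
    ultimately show ?thesis by blast
  qed
qed

section \<open>Reflection\<close>

lemma unary_eq_iff: "unary X = unary Y \<longleftrightarrow> X = Y"
  unfolding unary_def by (simp add: inj_image_eq_iff inj_def)

lemma binary_eq_iff: "binary X = binary Y \<longleftrightarrow> X = Y"
  unfolding binary_def by (rule inj_image_eq_iff) (auto simp: inj_def)

lemma small_subset: "X \<subseteq> elts x \<Longrightarrow> small X"
  unfolding small_def using separation[of x "\<lambda>z. z \<in> X"] by (metis Collect_mem_eq Int_absorb1 Int_def)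

definition card_in_Reg :: "'v::zfc_universe \<Rightarrow> 'v set \<Rightarrow> ('v \<times> 'v) set \<Rightarrow> bool" where
  "card_in_Reg \<alpha> X Z \<longleftrightarrow> Well_order Z \<and> otype Z \<in> elts \<alpha> \<and> vcard X \<in> Reg (otype Z)"

lemma gq_rel_hartig:
  "[unary X, unary Y] \<in> gq_rel hartig A \<longleftrightarrow> X \<subseteq> A \<and> Y \<subseteq> A \<and> X \<approx> Y"
  by (auto simp: hartig_def unary_eq_iff)

lemma gq_rel_reg_quantifier:
  "[unary X, binary Z] \<in> gq_rel (reg_quantifier \<alpha>) A \<longleftrightarrow>
    X \<subseteq> A \<and> Z \<subseteq> A \<times> A \<and> card_in_Reg \<alpha> X Z"
  by (auto simp: reg_quantifier_def card_in_Reg_def unary_eq_iff binary_eq_iff)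

text \<open>The logical content of the Loewenheim-Skolem-Tarski property that the argument uses, freed from
  syntax: two formulas, one for each quantifier, and closure under finitely many partial
  operations on \<open>A\<close>. Both formulas are built from a single ternary relation \<open>x \<le> y < z\<close>, which
  defines the set of predecessors of \<open>z\<close> (take \<open>x = y\<close>) as well as the order on it.\<close>

lemma LST_reflection:
  fixes \<kappa> \<alpha> :: "'v::zfc_universe"
  assumes inf: "infinite (elts \<kappa>)" and LST: "LST_property [hartig, reg_quantifier \<alpha>] \<kappa>"
    and A: "small A" "A \<noteq> {}" and Fs: "finite (Fs :: ('v \<Rightarrow> 'v \<Rightarrow> 'v) set)"
  obtains B where "B \<subseteq> A" "B \<noteq> {}" "B \<prec> elts \<kappa>"
    "\<And>F x y. F \<in> Fs \<Longrightarrow> x \<in> B \<Longrightarrow> y \<in> B \<Longrightarrow> F x y \<in> A \<Longrightarrow> F x y \<in> B"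
    "\<And>x y. x \<in> B \<Longrightarrow> y \<in> B \<Longrightarrow>
      B \<inter> elts x \<approx> B \<inter> elts y \<longleftrightarrow> A \<inter> elts x \<approx> A \<inter> elts y"
    "\<And>x y. x \<in> B \<Longrightarrow> y \<in> B \<Longrightarrow>
      card_in_Reg \<alpha> (B \<inter> elts x) (ord_relation y \<inter> B \<times> B) \<longleftrightarrow>
      card_in_Reg \<alpha> (A \<inter> elts x) (ord_relation y \<inter> A \<times> A)"
proof -
  let ?Qs = "[hartig, reg_quantifier \<alpha>]"
  obtain a0 where a0: "a0 \<in> A" using A by blast
  \<comment> \<open>The symbols must be elements of the universe: \<open>h\<close> codes the relation symbol as the image of
      \<open>None\<close> and each operation \<open>F\<close> as the image of \<open>Some F\<close>.\<close>
  let ?I = "insert None (Some ` Fs)"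
  obtain h where h: "inj_on h ?I" "h ` ?I \<subseteq> elts \<kappa>"
    using finite_lepoll_infinite[OF inf, of ?I] Fs unfolding lepoll_def by auto
  define r where "r = h None"
  define L where "L = \<lparr> rel_syms = {r}, fun_syms = (\<lambda>F. h (Some F)) ` Fs,
    arity = (\<lambda>s. if s = r then 3 else 2) \<rparr>"
  define op where "op s = the (inv_into ?I h s)" for s
  \<comment> \<open>Operations leading outside \<open>A\<close> are redirected to the arbitrary element \<open>a0\<close>.\<close>
  define M where "M = \<lparr> domain = A,
    rel_interp = (\<lambda>s. {[x, y, z] | x y z. x \<in> A \<and> y \<in> A \<and> z \<in> A \<and> (x, y) \<in> ord_relation z}),
    fun_interp = (\<lambda>s xs. let w = op s (xs ! 0) (xs ! 1) in if w \<in> A then w else a0) \<rparr>"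
  have r_ne: "h (Some F) \<noteq> r" if "F \<in> Fs" for F
    using h(1) that unfolding r_def inj_on_def by blast
  have op: "op (h (Some F)) = F" if "F \<in> Fs" for F
    unfolding op_def using h(1) that by (subst inv_into_f_f) auto
  have sym: "symbols L = h ` ?I"
    unfolding symbols_def L_def r_def by auto
  have voc: "is_vocabulary L"
    unfolding is_vocabulary_def sym using small_subset[OF h(2)] r_ne by (auto simp: L_def)
  have "symbols L \<prec> elts \<kappa>"
    unfolding sym using Fs inf by (simp add: finite_lesspoll_infinite)
  moreover have "is_structure L M"
    unfolding is_structure_def using A a0
    by (auto simp: L_def M_def tuples_def Let_def)
  ultimately obtain N where N: "elementary_substructure L ?Qs N M" "domain N \<prec> elts \<kappa>"
    using LST voc unfolding LST_property_def by blast
  define B where "B = domain N"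
  have sub: "substructure L N M" using N unfolding elementary_substructure_def by blast
  then have B: "B \<subseteq> A" "B \<noteq> {}"
    unfolding substructure_def is_structure_def B_def M_def by auto
  have relN: "rel_interp N r = {[x, y, z] | x y z. x \<in> B \<and> y \<in> B \<and> z \<in> B \<and> (x, y) \<in> ord_relation z}"
    using sub B(1) unfolding substructure_def B_def by (auto simp: L_def M_def tuples_def)
  have funN: "F x y \<in> B" if F: "F \<in> Fs" "x \<in> B" "y \<in> B" "F x y \<in> A" for F x y
  proof -
    let ?f = "h (Some F)"
    have args: "?f \<in> fun_syms L" "[x, y] \<in> tuples (domain N) (arity L ?f)"
      using F r_ne[OF F(1)] unfolding B_def by (auto simp: L_def tuples_def)
    have "fun_interp N ?f [x, y] = fun_interp M ?f [x, y]" "fun_interp N ?f [x, y] \<in> domain N"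
      using sub args unfolding substructure_def is_structure_def by blast+
    moreover have "fun_interp M ?f [x, y] = F x y"
      using F(4) op[OF F(1)] by (simp add: M_def)
    ultimately show ?thesis unfolding B_def by simp
  qed
  \<comment> \<open>Variables 0 and 1 are the bound ones. In \<open>GQ 1 [seg 1, ord]\<close> the parameter \<open>a 1\<close> is still
      available to \<open>seg 1\<close>, because only \<open>ord\<close> binds variable 1; the parameter of \<open>ord\<close> has to be another
      variable.\<close>
  define seg where "seg i = ([0::nat], Rl r [Var 0, Var 0, Var i])" for i
  define ord where "ord = ([0::nat, 1], Rl r [Var 0, Var 1, Var 3])"
  have rel: "[u,v,w] \<in> rel_interp K r \<longleftrightarrow> u \<in> domain K \<and> v \<in> domain K \<and> w \<in> domain K \<and> (u,v) \<in> ord_relation w"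
    if "K = M \<or> K = N" for K u v w
    using that relN unfolding M_def B_def by auto
  have seg: "{xs \<in> tuples (domain K) (length (fst (seg i))). sat K ?Qs (assign a (fst (seg i)) xs) (snd (seg i))} 
    = unary (domain K \<inter> elts (a i))"
    if "K = M \<or> K = N" "a i \<in> domain K" "i \<noteq> 0" for K a i
    using that rel[OF that(1)] unfolding seg_def
    by (auto simp: tuples_def unary_def assign_def length_Suc_conv ord_relation_def ord_le_def)
  have ord: "{xs \<in> tuples (domain K) (length (fst ord)). sat K ?Qs (assign a (fst ord) xs) (snd ord)} 
    = binary (ord_relation (a 3) \<inter> domain K \<times> domain K)"
    if "K = M \<or> K = N" "a 3 \<in> domain K" for K a
    using that rel[OF that(1)] unfolding ord_def
    by (auto simp: tuples_def binary_def assign_def length_Suc_conv numeral_2_eq_2)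
  have el: "sat N ?Qs a \<phi> \<longleftrightarrow> sat M ?Qs a \<phi>" if "wf_fm L ?Qs \<phi>" "range a \<subseteq> B" for a \<phi>
    using N that unfolding elementary_substructure_def B_def by blast
  have hartig: "sat K ?Qs a (GQ 0 [seg 1, seg 2]) \<longleftrightarrow>
      domain K \<inter> elts (a 1) \<approx> domain K \<inter> elts (a 2)"
    if "K = M \<or> K = N" "range a \<subseteq> domain K" for K a
  proof -
    have "a 1 \<in> domain K" "a 2 \<in> domain K" using that(2) by auto
    then show ?thesis
      using seg[OF that(1), of a 1] seg[OF that(1), of a 2]
      by (simp add: case_prod_unfold gq_rel_hartig del: One_nat_def)
  qed
  have regq: "sat K ?Qs a (GQ 1 [seg 1, ord]) \<longleftrightarrow>
      card_in_Reg \<alpha> (domain K \<inter> elts (a 1)) (ord_relation (a 3) \<inter> domain K \<times> domain K)"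
    if "K = M \<or> K = N" "range a \<subseteq> domain K" for K a
  proof -
    have "a 1 \<in> domain K" "a 3 \<in> domain K" using that(2) by auto
    then show ?thesis
      using seg[OF that(1), of a 1] ord[OF that(1), of a]
      by (simp add: case_prod_unfold gq_rel_reg_quantifier del: One_nat_def)
  qed
  have wf: "wf_fm L ?Qs (GQ 0 [seg 1, seg 2])" "wf_fm L ?Qs (GQ 1 [seg 1, ord])"
    by (auto simp: seg_def ord_def L_def hartig_def reg_quantifier_def)
  have dom: "domain M = A" "domain N = B" unfolding M_def B_def by auto
  show thesis
  proof (rule that[of B])
    fix x y assume xy: "x \<in> B" "y \<in> B"
    define a where "a i = (if i = 1 then x else y)" for i :: nat
    have a: "range a \<subseteq> B" "a 1 = x" "a 2 = y" "a 3 = y" unfolding a_def using xy by auto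
    then show "B \<inter> elts x \<approx> B \<inter> elts y \<longleftrightarrow> A \<inter> elts x \<approx> A \<inter> elts y"
      using el[OF wf(1) a(1)] hartig[of M a] hartig[of N a] B(1) unfolding dom by auto
    show "card_in_Reg \<alpha> (B \<inter> elts x) (ord_relation y \<inter> B \<times> B) \<longleftrightarrow>
      card_in_Reg \<alpha> (A \<inter> elts x) (ord_relation y \<inter> A \<times> A)"
      using el[OF wf(2) a(1)] regq[of M a] regq[of N a] B(1) a unfolding dom by auto
  qed (use B N funN dom in auto)
qed

section \<open>The lower bound\<close>

lemma card_in_Reg_ordinals:
  assumes "Ord \<beta>"
  shows "card_in_Reg \<alpha> X (ord_relation \<beta>) \<longleftrightarrow> \<beta> \<in> elts \<alpha> \<and> vcard X \<in> Reg \<beta>"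
  using assms unfolding card_in_Reg_def
  by (simp add: otype_ord_relation Well_order_ord_relation)

lemma small_insert_self: "small (insert \<kappa> (elts (\<kappa>::'v::zfc_universe)))"
proof -
  obtain s where s: "elts s = {\<kappa>, \<kappa>}" using pairing by blast
  obtain p where p: "elts p = {\<kappa>, s}" using pairing by blast
  obtain u where "elts u = \<Union> (elts ` elts p)" using union by blast
  then show ?thesis
    using s p unfolding small_def by (intro exI[of _ u]) auto
qed

text \<open>The gap argument: the least element \<open>\<rho>\<close> of the elementary substructure above its first missing
  ordinal \<open>\<delta>\<close> is the required cardinal.\<close>

lemma LST_bounds_Reg_ge:
  fixes \<alpha> \<kappa> :: "'v::zfc_universe"
  assumes w: "is_omega \<omega>" and ord: "Ord \<alpha>"
    and nohyper: "\<not> (\<exists>\<epsilon>\<in>elts \<alpha>. hyperinaccessible \<epsilon>)"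
    and k: "infinite_cardinal \<kappa>" and LST: "LST_property [hartig, reg_quantifier \<alpha>] \<kappa>"
  obtains \<rho> where "\<rho> \<in> Reg_ge \<alpha>" "\<omega> \<in> elts \<rho>" "ord_le \<rho> \<kappa>"
proof -
  have ok: "Ord \<kappa>" "infinite (elts \<kappa>)" "is_cardinal \<kappa>"
    using k unfolding infinite_cardinal_def is_cardinal_def by auto
  let ?unctble_reg = "\<lambda>\<rho>. \<rho> \<in> regulars \<and> \<omega> \<in> elts \<rho>"
  have "\<forall>\<rho>. \<exists>\<theta> g. Ord \<rho> \<and> elts \<rho> \<noteq> {} \<and> \<not> ?unctble_reg \<rho> \<longrightarrow>
    \<theta> \<in> elts \<rho> \<and> (\<forall>\<delta>\<in>elts \<rho>. \<theta> \<in> elts \<delta> \<longrightarrow> (\<exists>\<xi>\<in>elts \<delta>. g \<xi> \<in> elts \<rho> - elts \<delta>))"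
    using not_uncountable_regular_escape[OF w] by (metis (no_types, lifting))
  then obtain \<theta> g where escape: "\<And>\<rho>. Ord \<rho> \<Longrightarrow> elts \<rho> \<noteq> {} \<Longrightarrow> \<not> ?unctble_reg \<rho> \<Longrightarrow>
    \<theta> \<rho> \<in> elts \<rho> \<and> (\<forall>\<delta>\<in>elts \<rho>. \<theta> \<rho> \<in> elts \<delta> \<longrightarrow> (\<exists>\<xi>\<in>elts \<delta>. g \<rho> \<xi> \<in> elts \<rho> - elts \<delta>))"
    by metis
  define index where "index \<rho> = (SOME \<beta>. \<beta> \<in> elts \<alpha> \<and> \<rho> \<in> Reg \<beta>)" for \<rho>
  have index: "index \<rho> \<in> elts \<alpha> \<and> \<rho> \<in> Reg (index \<rho>)"
    if "\<beta> \<in> elts \<alpha>" "\<rho> \<in> Reg \<beta>" for \<rho> \<beta>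
    unfolding index_def by (rule someI[of _ \<beta>]) (simp add: that)
  let ?C = "\<lambda>\<rho>. closed_class hull Reg_ge (index \<rho>)"
  have "\<forall>\<rho>. \<exists>\<sigma>. \<rho> \<in> Reg (index \<rho>) \<longrightarrow>
    \<sigma> \<in> elts \<rho> \<and> \<not> (\<exists>\<epsilon>\<in>?C \<rho>. \<sigma> \<in> elts \<epsilon> \<and> \<epsilon> \<in> elts \<rho>)"
    unfolding Reg_eq successor_elements_def by blast
  then obtain pred where pred: "\<And>\<rho>. \<rho> \<in> Reg (index \<rho>) \<Longrightarrow>
    pred \<rho> \<in> elts \<rho> \<and> \<not> (\<exists>\<epsilon>\<in>?C \<rho>. pred \<rho> \<in> elts \<epsilon> \<and> \<epsilon> \<in> elts \<rho>)"
    by metis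
  define A where "A = insert \<kappa> (elts \<kappa>)"
  have A: "Ord x" "elts x \<subseteq> A" "ord_le x \<kappa>" if "x \<in> A" for x
    using that ok(1) Ord_mem[OF ok(1), of x] Ord_subset[OF ok(1), of x] unfolding A_def ord_le_def by auto
  have smallA: "small A" "A \<noteq> {}"
    using small_insert_self unfolding A_def by auto
  \<comment> \<open>The constant \<open>\<kappa>\<close> ensures that \<open>B\<close> has an element above \<open>\<delta>\<close>. The operations \<open>\<theta>\<close> and \<open>g\<close> witness
      failure of uncountable regularity, and \<open>index\<close> and \<open>pred\<close> witness membership in \<open>Reg \<beta>\<close> for some
      \<open>\<beta> < \<alpha>\<close>.\<close>
  let ?Fs = "{\<lambda>_ _. \<kappa>, \<lambda>\<rho> _. \<theta> \<rho>, g, \<lambda>\<rho> _. index \<rho>, \<lambda>\<rho> _. pred \<rho>}"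
  have "finite ?Fs" by simp
  from LST_reflection[OF ok(2) LST smallA this]
  obtain B where B: "B \<subseteq> A" "B \<noteq> {}" "B \<prec> elts \<kappa>"
    and closed: "\<And>F x y. F \<in> ?Fs \<Longrightarrow> x \<in> B \<Longrightarrow> y \<in> B \<Longrightarrow> F x y \<in> A \<Longrightarrow> F x y \<in> B"
    and hartig: "\<And>x y. x \<in> B \<Longrightarrow> y \<in> B \<Longrightarrow>
      B \<inter> elts x \<approx> B \<inter> elts y \<longleftrightarrow> A \<inter> elts x \<approx> A \<inter> elts y"
    and regq: "\<And>x y. x \<in> B \<Longrightarrow> y \<in> B \<Longrightarrow>
      card_in_Reg \<alpha> (B \<inter> elts x) (ord_relation y \<inter> B \<times> B) \<longleftrightarrow>
      card_in_Reg \<alpha> (A \<inter> elts x) (ord_relation y \<inter> A \<times> A)"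
    by blast
  have kB: "\<kappa> \<in> B" using closed[of "\<lambda>_ _. \<kappa>"] B unfolding A_def by blast
  have "\<not> elts \<kappa> \<subseteq> B"
    using B(3) subset_imp_lepoll lesspoll_def lepoll_antisym by blast
  then obtain \<delta> where d: "is_least \<delta> (elts \<kappa> - B)"
    using is_least_exists[of "elts \<kappa> - B"] Ord_mem[OF ok(1)] by blast
  have dk: "\<delta> \<in> elts \<kappa>" "\<delta> \<notin> B" "Ord \<delta>"
    using d Ord_mem[OF ok(1), of \<delta>] unfolding is_least_def by auto
  have dB: "elts \<delta> \<subseteq> B"
    using d dk ok(1) ord_leD Ord_trans[OF ok(1) dk(1)] unfolding is_least_def by blast
  obtain \<rho> where r: "is_least \<rho> {x \<in> B. \<delta> \<in> elts x}"
    using is_least_exists[of "{x \<in> B. \<delta> \<in> elts x}"] kB dk(1) B(1) A(1) by blast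
  have rB: "\<rho> \<in> B" "\<delta> \<in> elts \<rho>" "\<rho> \<in> A" "Ord \<rho>" "elts \<rho> \<subseteq> A" "ord_le \<rho> \<kappa>"
    using r B(1) A unfolding is_least_def by blast+
  have gap: "B \<inter> elts \<rho> = elts \<delta>"
  proof
    show "elts \<delta> \<subseteq> B \<inter> elts \<rho>" using dB Ord_subset[OF rB(4,2)] by blast
    show "B \<inter> elts \<rho> \<subseteq> elts \<delta>"
    proof
      fix x assume x: "x \<in> B \<inter> elts \<rho>"
      then have "\<delta> \<notin> elts x"
        using r ord_leD[of \<rho> x] unfolding is_least_def by blast
      then show "x \<in> elts \<delta>"
        using x dk(2) Ord_linear[OF Ord_mem[OF rB(4), of x] dk(3)] by blast
    qed
  qed
  have below: "F \<rho> x \<in> elts \<delta>" if "F \<in> ?Fs" "x \<in> B" "F \<rho> x \<in> elts \<rho>" for F x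
    using closed[OF that(1) rB(1) that(2)] that(3) rB(5) gap by blast
  have unctble_reg: "?unctble_reg \<rho>"
  proof (rule ccontr)
    assume "\<not> ?unctble_reg \<rho>"
    then have e: "\<theta> \<rho> \<in> elts \<rho>"
      "\<And>\<delta>. \<delta> \<in> elts \<rho> \<Longrightarrow> \<theta> \<rho> \<in> elts \<delta> \<Longrightarrow> \<exists>\<xi>\<in>elts \<delta>. g \<rho> \<xi> \<in> elts \<rho> - elts \<delta>"
      using escape[OF rB(4)] rB(2) by blast+
    have "\<theta> \<rho> \<in> elts \<delta>" using below[of "\<lambda>\<rho> _. \<theta> \<rho>", OF _ rB(1)] e(1) by blast
    then obtain \<xi> where "\<xi> \<in> elts \<delta>" "g \<rho> \<xi> \<in> elts \<rho> - elts \<delta>"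
      using e(2) rB(2) by blast
    then show False using below[of g \<xi>] dB by blast
  qed
  have "\<rho> \<notin> Reg \<beta>" if b: "\<beta> \<in> elts \<alpha>" for \<beta>
  proof
    assume "\<rho> \<in> Reg \<beta>"
    define i where "i = index \<rho>"
    have i: "i \<in> elts \<alpha>" "\<rho> \<in> Reg i" "Ord i"
      using index[OF b \<open>\<rho> \<in> Reg \<beta>\<close>] ord Ord_mem unfolding i_def by blast+
    have card: "is_cardinal \<rho>"
      using unctble_reg unfolding regulars_def infinite_cardinal_def by blast
    have "ord_le i \<rho>"
      using index_le_Reg_ge[OF w i(3)] i(2) Reg_subset_Reg_ge unctble_reg by blast
    then have "i \<in> elts \<rho>"
      using nohyper i card unfolding ord_le_def hyperinaccessible_def by blast
    then have id: "i \<in> elts \<delta>"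
      using below[of "\<lambda>\<rho> _. index \<rho>", OF _ rB(1)] unfolding i_def by blast
    define s where "s = pred \<rho>"
    have s: "s \<in> elts \<rho>" "\<not> (\<exists>\<epsilon>\<in>?C \<rho>. s \<in> elts \<epsilon> \<and> \<epsilon> \<in> elts \<rho>)"
      using pred[of \<rho>] i(2) unfolding i_def s_def by blast+
    then have sd: "s \<in> elts \<delta>"
      using below[of "\<lambda>\<rho> _. pred \<rho>", OF _ rB(1)] unfolding s_def by blast
    have sub: "elts i \<subseteq> B" "elts i \<subseteq> A" "elts s \<subseteq> B" "elts s \<subseteq> A"
      using Ord_subset[OF dk(3) id] Ord_subset[OF dk(3) sd] dB B(1) by blast+
    define \<tau> where "\<tau> = vcard (elts \<delta>)"
    note t = vcard_Ord[OF dk(3), folded \<tau>_def]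
    have "ord_relation i \<inter> A \<times> A = ord_relation i" "ord_relation i \<inter> B \<times> B = ord_relation i"
      using sub unfolding ord_relation_def by auto
    moreover have "A \<inter> elts \<rho> = elts \<rho>" using rB(5) by blast
    moreover have "i \<in> B" "s \<in> B" using id sd dB by blast+
    \<comment> \<open>Reflection replaces \<open>\<rho>\<close> by \<open>B \<inter> \<rho> = \<delta>\<close> but keeps the order type \<open>i\<close>, as \<open>i\<close> is contained in \<open>B\<close>.\<close>
    ultimately have "\<tau> \<in> Reg i"
      using regq[OF rB(1) \<open>i \<in> B\<close>] i card_in_Reg_ordinals[OF i(3)] vcard_cardinal[OF card] gap
      unfolding \<tau>_def by simp
    have "\<not> elts s \<approx> elts \<rho>" using card s(1) unfolding is_cardinal_def by blast
    then have ns: "\<not> elts s \<approx> elts \<delta>"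
      using hartig[OF \<open>s \<in> B\<close> rB(1)] sub gap \<open>A \<inter> elts \<rho> = elts \<rho>\<close>
      by (simp add: Int_absorb1)
    have os: "Ord s" "Ord \<tau>" using sd dk(3) Ord_mem t(1) unfolding is_cardinal_def by blast+
    \<comment> \<open>Otherwise \<open>\<tau> \<le> s < \<delta>\<close>, which squeezes \<open>s\<close> between two equipollent ordinals.\<close>
    have "s \<in> elts \<tau>"
    proof (rule ccontr)
      assume "s \<notin> elts \<tau>"
      then have "elts \<tau> \<subseteq> elts s" using ord_le_subset[OF os(1)] ord_leI[OF os(2,1)] by blast
      then have "elts \<delta> \<lesssim> elts s"
        using t(2) by (meson eqpoll_imp_lepoll lepoll_trans subset_imp_lepoll)
      moreover have "elts s \<lesssim> elts \<delta>"
        using subset_imp_lepoll[OF Ord_subset[OF dk(3) sd]] .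
      ultimately show False using ns lepoll_antisym by blast
    qed
    moreover have "\<tau> \<in> elts \<rho>"
      using ord_le_mem_trans[OF rB(4) t(3) rB(2)] .
    moreover have "\<tau> \<in> ?C \<rho>"
      using \<open>\<tau> \<in> Reg i\<close> unfolding i_def Reg_eq successor_elements_def by blast
    ultimately show False using s(2) by blast
  qed
  then have "\<rho> \<in> Reg_ge \<alpha>" using unctble_reg unfolding Reg_ge_def by blast
  then show thesis using that unctble_reg rB(6) by blast
qed

theorem theorem4p4:
  fixes \<alpha> \<kappa> :: "'v::zfc_universe"
  assumes "Ord \<alpha>" and "elts \<alpha> \<noteq> {}"
    and "\<not> (\<exists>\<epsilon>\<in>elts \<alpha>. hyperinaccessible \<epsilon>)"
    and "is_LST [hartig, reg_quantifier \<alpha>] \<kappa>"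
  shows "\<exists>\<mu>. is_least \<mu> (Reg \<alpha>) \<and> ord_le \<mu> \<kappa>"
proof -
  have k: "infinite_cardinal \<kappa>" "LST_property [hartig, reg_quantifier \<alpha>] \<kappa>"
    using assms(4) unfolding is_LST_def is_least_def by auto
  have ok: "Ord \<kappa>" "infinite (elts \<kappa>)"
    using k(1) unfolding infinite_cardinal_def is_cardinal_def by auto
  then obtain \<omega> :: 'v where w: "is_omega \<omega>"
    unfolding is_omega_def using is_least_exists[of "{\<gamma>. Ord \<gamma> \<and> infinite (elts \<gamma>)}"] by blast
  obtain \<rho> where r: "\<rho> \<in> Reg_ge \<alpha>" "\<omega> \<in> elts \<rho>" "ord_le \<rho> \<kappa>"
    using LST_bounds_Reg_ge[OF w assms(1,3) k] .
  then have "\<rho> \<in> closed_class hull Reg_ge \<alpha>"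
    using hull_subset by fastforce
  then obtain \<mu> where "is_least \<mu> (Reg \<alpha>)" "ord_le \<mu> \<rho>"
    using least_Reg[OF w] r(2) by blast
  moreover have "ord_le \<mu> \<kappa>"
    using ord_le_trans[OF ok(1) \<open>ord_le \<mu> \<rho>\<close> r(3)] .
  ultimately show ?thesis by blast
qed

end
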